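(* Let $\mathcal{I}$ be a nonempty collection of subsets of $\{1,\ldots,n\}$ with $\emptyset\notin\mathcal{I}$, let $\hat c\in\mathbb{R}^n$ with $\hat c\ge 0$, let $d\in\mathbb{R}^n$ with $d>0$ (componentwise), and let $\Gamma\ge 1$ be an integer. Let $\mathcal{Z}$, $\mathcal{Z}_\eta$ and $\mathbb{H}$ be the budget uncertainty set, the reduced uncertainty set and the interval defined in the context. Let $\tilde I\in\mathcal{I}$. Then $$\max_{z\in\mathcal{Z}_\eta}\sum_{j\in\tilde I}(\hat c_j+d_jz_j)<\max_{z\in\mathcal{Z}}\sum_{j\in\tilde I}(\hat c_j+d_jz_j)\qquad\forall\,\eta\in\mathbb{H}$$ if and only if for every optimal solution $\tilde z$ of $\max_{z\in\mathcal{Z}}\sum_{j\in\tilde I}(\hat c_j+d_jz_j)$ there exists an optimal solution $I^*=I^*(\tilde z)$ of the non-robust problem $\min_{I\in\mathcal{I}}\sum_{j\in I}\hat c_j$ that satisfies $\mathrm{supp}(\tilde z)\cap I^*=\emptyset$.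
   Context: Definitions: the budget uncertainty set is $\mathcal{Z}:=\{z\in[0,1]^n:\sum_{j=1}^nz_j\le\Gamma\}$. For $\eta\in\mathbb{R}$ the reduced uncertainty set is $\mathcal{Z}_\eta:=\{z\in\mathcal{Z}:\min_{I\in\mathcal{I}}\sum_{j\in I}(\hat c_j+d_jz_j)\ge\eta\}$. The half-open interval $$\mathbb{H}:=\Big(\min_{I\in\mathcal{I}}\sum_{j\in I}\hat c_j,\ \max_{z\in\mathcal{Z}}\min_{I\in\mathcal{I}}\sum_{j\in I}(\hat c_j+d_jz_j)\Big].$$ For $z\in\mathcal{Z}$, $\mathrm{supp}(z):=\{j:z_j>0\}$. *)

theory Defs
  imports "HOL-Analysis.Finite_Cartesian_Product"
begin

text \<open>
  The ground set \<open>{1, \<dots>, n}\<close> is a finite type \<open>'n\<close>, and vectors in \<open>\<real>\<^sup>n\<close> have type \<open>real ^ 'n\<close>.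
  A collection of subsets of the ground set has type \<open>'n set set\<close> and is therefore finite, so
  minima over it are written with \<^const>\<open>Min\<close>.
\<close>

definition budget_set :: "nat \<Rightarrow> (real ^ 'n) set" where
  "budget_set \<Gamma> = {z. (\<forall>j. z $ j \<in> {0..1}) \<and> (\<Sum>j\<in>UNIV. z $ j) \<le> real \<Gamma>}"

definition nominal_cost :: "real ^ 'n \<Rightarrow> 'n set \<Rightarrow> real" where
  "nominal_cost c I = (\<Sum>j\<in>I. c $ j)"

definition scenario_cost :: "real ^ 'n \<Rightarrow> real ^ 'n \<Rightarrow> 'n set \<Rightarrow> real ^ 'n \<Rightarrow> real" where
  "scenario_cost c d I z = (\<Sum>j\<in>I. c $ j + d $ j * z $ j)"

definition min_scenario_cost ::
    "'n set set \<Rightarrow> real ^ 'n \<Rightarrow> real ^ 'n \<Rightarrow> real ^ 'n \<Rightarrow> real" where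
  "min_scenario_cost \<I> c d z = Min ((\<lambda>I. scenario_cost c d I z) ` \<I>)"

definition reduced_set ::
    "'n set set \<Rightarrow> real ^ 'n \<Rightarrow> real ^ 'n \<Rightarrow> nat \<Rightarrow> real \<Rightarrow> (real ^ 'n) set" where
  "reduced_set \<I> c d \<Gamma> \<eta> = {z \<in> budget_set \<Gamma>. min_scenario_cost \<I> c d z \<ge> \<eta>}"

text \<open>
  The maximum of a real function over a possibly infinite set is the greatest element of its image;
  it is a meaningful value only if the maximum is attained.
\<close>

definition max_over :: "'a set \<Rightarrow> ('a \<Rightarrow> real) \<Rightarrow> real" where
  "max_over S f = (GREATEST v. v \<in> f ` S)"

definition eta_interval :: "'n set set \<Rightarrow> real ^ 'n \<Rightarrow> real ^ 'n \<Rightarrow> nat \<Rightarrow> real set" where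
  "eta_interval \<I> c d \<Gamma> =
     {Min (nominal_cost c ` \<I>) <.. max_over (budget_set \<Gamma>) (min_scenario_cost \<I> c d)}"

definition supp :: "real ^ 'n \<Rightarrow> 'n set" where
  "supp z = {j. z $ j > 0}"

end

theory Submission
  imports Defs "HOL-Analysis.Cartesian_Euclidean_Space"
begin

text \<open>
  A scenario \<open>z\<close> has worst-case value \<open>min\<^sub>I \<Sum>\<^sub>j\<^sub>\<in>\<^sub>I (c\<^sub>j + d\<^sub>j z\<^sub>j)\<close> above the nominal optimum exactly
  if its support meets every nominally optimal set. Hence an optimal scenario for \<open>J\<close> whose
  support meets all of them survives in the reduced set for \<open>\<eta>\<close> equal to its own worst-case value,
  so that the maximum does not drop. Conversely, by compactness a maximum over the reduced set
  that does not drop is attained at an optimal scenario of value at least \<open>\<eta>\<close>.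
\<close>

lemma max_over_eq:
  assumes "z \<in> S" and "\<And>y. y \<in> S \<Longrightarrow> f y \<le> f z"
  shows "max_over S f = f z"
  unfolding max_over_def using assms by (intro Greatest_equality) auto

lemma compact_budget_set: "compact (budget_set \<Gamma> :: (real ^ 'n::finite) set)"
proof -
  have "(budget_set \<Gamma> :: (real ^ 'n) set) = cbox 0 1 \<inter> {z. (\<Sum>j\<in>UNIV. z $ j) \<le> real \<Gamma>}"
    by (auto simp: budget_set_def mem_box_cart)
  moreover have "closed {z :: real ^ 'n. (\<Sum>j\<in>UNIV. z $ j) \<le> real \<Gamma>}"
    by (intro closed_Collect_le continuous_intros)
  ultimately show ?thesis
    by (simp add: compact_Int_closed)
qed

lemma zero_in_budget_set: "0 \<in> budget_set \<Gamma>"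
  by (simp add: budget_set_def)

text \<open>By induction on the finite index set, since a binary \<open>min\<close> of continuous
  functions is continuous. Applied to the scenario costs, this makes the worst-case value
  continuous.\<close>

lemma continuous_on_Min_image:
  fixes f :: "'i \<Rightarrow> 'a::topological_space \<Rightarrow> real"
  assumes "finite A" and "A \<noteq> {}" and "\<And>i. i \<in> A \<Longrightarrow> continuous_on S (f i)"
  shows "continuous_on S (\<lambda>x. Min ((\<lambda>i. f i x) ` A))"
  using assms
proof (induction rule: finite_ne_induct)
  case (insert i A)
  then show ?case
    by (simp add: continuous_on_min)
qed simp

lemma continuous_on_scenario_cost: "continuous_on S (scenario_cost c d I)"
  unfolding scenario_cost_def by (intro continuous_intros)

lemma continuous_on_min_scenario_cost:
  fixes \<I> :: "'n::finite set set"
  assumes "\<I> \<noteq> {}"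
  shows "continuous_on S (min_scenario_cost \<I> c d)"
  unfolding min_scenario_cost_def
  using assms by (intro continuous_on_Min_image continuous_on_scenario_cost) auto

text \<open>Extreme value theorem. It guarantees that \<open>max_over\<close> denotes an actual
  value of the function, which \<open>GREATEST\<close> alone does not.\<close>

lemma max_over_attained:
  fixes f :: "'a::topological_space \<Rightarrow> real"
  assumes "compact S" and "S \<noteq> {}" and "continuous_on S f"
  obtains z where "z \<in> S" and "\<And>y. y \<in> S \<Longrightarrow> f y \<le> f z" and "max_over S f = f z"
  using continuous_attains_sup[OF assms] max_over_eq by metis

text \<open>A superlevel set of the continuous worst-case value is closed, and it is cut out of a
  compact set.\<close>

lemma compact_reduced_set:
  fixes \<I> :: "'n::finite set set"
  assumes "\<I> \<noteq> {}"
  shows "compact (reduced_set \<I> c d \<Gamma> \<eta>)"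
proof -
  have "reduced_set \<I> c d \<Gamma> \<eta> = budget_set \<Gamma> \<inter> {z. \<eta> \<le> min_scenario_cost \<I> c d z}"
    by (auto simp: reduced_set_def)
  moreover have "closed {z. \<eta> \<le> min_scenario_cost \<I> c d z}"
    by (intro closed_Collect_le continuous_on_const continuous_on_min_scenario_cost assms)
  ultimately show ?thesis
    by (simp add: compact_Int_closed compact_budget_set)
qed

lemma scenario_cost_eq:
  "scenario_cost c d I z = nominal_cost c I + (\<Sum>j\<in>I. d $ j * z $ j)"
  by (simp add: scenario_cost_def nominal_cost_def sum.distrib)

text \<open>The surplus over the nominal cost is a sum of nonnegative terms, so it vanishes only
  termwise; as \<open>d\<close> is positive, a term vanishes exactly off the support.\<close>

lemma scenario_cost_eq_nominal_iff:
  fixes c d :: "real ^ 'n::finite"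
  assumes "\<forall>j. d $ j > 0" and "z \<in> budget_set \<Gamma>"
  shows "scenario_cost c d I z = nominal_cost c I \<longleftrightarrow> supp z \<inter> I = {}"
proof -
  have nonneg: "z $ j \<ge> 0" for j
    using assms(2) by (simp add: budget_set_def)
  then have "(\<Sum>j\<in>I. d $ j * z $ j) = 0 \<longleftrightarrow> (\<forall>j\<in>I. d $ j * z $ j = 0)"
    using assms(1) by (intro sum_nonneg_eq_0_iff) (auto simp: less_imp_le)
  moreover have "d $ j * z $ j = 0 \<longleftrightarrow> j \<notin> supp z" for j
    using assms(1)[rule_format, of j] nonneg[of j] by (auto simp: supp_def)
  ultimately show ?thesis
    by (auto simp: scenario_cost_eq)
qed

lemma nominal_cost_le_scenario_cost:
  fixes c d :: "real ^ 'n::finite"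
  assumes "\<forall>j. d $ j > 0" and "z \<in> budget_set \<Gamma>"
  shows "nominal_cost c I \<le> scenario_cost c d I z"
  using assms by (auto simp: scenario_cost_eq budget_set_def less_imp_le intro!: sum_nonneg)

lemma is_arg_min_nominal_cost_iff:
  fixes \<I> :: "'n::finite set set"
  shows "is_arg_min (nominal_cost c) (\<lambda>I. I \<in> \<I>) I \<longleftrightarrow>
         I \<in> \<I> \<and> nominal_cost c I = Min (nominal_cost c ` \<I>)"
proof
  assume "is_arg_min (nominal_cost c) (\<lambda>I. I \<in> \<I>) I"
  then show "I \<in> \<I> \<and> nominal_cost c I = Min (nominal_cost c ` \<I>)"
    by (auto simp: is_arg_min_linorder intro!: Min_eqI[symmetric])
next
  assume "I \<in> \<I> \<and> nominal_cost c I = Min (nominal_cost c ` \<I>)"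
  then show "is_arg_min (nominal_cost c) (\<lambda>I. I \<in> \<I>) I"
    by (auto simp: is_arg_min_linorder)
qed

text \<open>A minimum over a finite nonempty family exceeds \<open>?m\<close> iff every member does.
  Since \<open>?m\<close> \<le> nominal cost \<le> scenario cost, a set \<open>I\<close> fails to
  exceed \<open>?m\<close> only if both inequalities are equalities: \<open>I\<close> is nominally
  optimal and misses the support.\<close>

lemma min_scenario_cost_gt_iff:
  fixes \<I> :: "'n::finite set set"
  assumes "\<I> \<noteq> {}" and "\<forall>j. d $ j > 0" and z: "z \<in> budget_set \<Gamma>"
  shows "min_scenario_cost \<I> c d z > Min (nominal_cost c ` \<I>) \<longleftrightarrow>
         (\<nexists>I. is_arg_min (nominal_cost c) (\<lambda>I. I \<in> \<I>) I \<and> supp z \<inter> I = {})"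
proof -
  let ?m = "Min (nominal_cost c ` \<I>)"
  have "scenario_cost c d I z > ?m \<longleftrightarrow> \<not> (nominal_cost c I = ?m \<and> supp z \<inter> I = {})"
    if "I \<in> \<I>" for I
  proof -
    have "?m \<le> nominal_cost c I"
      using that by simp
    then show ?thesis
      using nominal_cost_le_scenario_cost[OF assms(2) z, of c I]
        scenario_cost_eq_nominal_iff[OF assms(2) z, of c I] by linarith
  qed
  then have "min_scenario_cost \<I> c d z > ?m \<longleftrightarrow>
      (\<forall>I\<in>\<I>. \<not> (nominal_cost c I = ?m \<and> supp z \<inter> I = {}))"
    using assms(1) by (simp add: min_scenario_cost_def)
  then show ?thesis
    by (auto simp: is_arg_min_nominal_cost_iff)
qed

theorem theorem2:
  fixes \<I> :: "'n::finite set set"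
    and c d :: "real ^ 'n"
    and \<Gamma> :: nat
    and J :: "'n set"
  assumes "\<I> \<noteq> {}" and "{} \<notin> \<I>"
    and "\<forall>j. c $ j \<ge> 0"
    and "\<forall>j. d $ j > 0"
    and "\<Gamma> \<ge> 1"
    and "J \<in> \<I>"
  shows "(\<forall>\<eta> \<in> eta_interval \<I> c d \<Gamma>.
            max_over (reduced_set \<I> c d \<Gamma> \<eta>) (scenario_cost c d J)
              < max_over (budget_set \<Gamma>) (scenario_cost c d J))
         \<longleftrightarrow>
         (\<forall>z. is_arg_max (scenario_cost c d J) (\<lambda>z. z \<in> budget_set \<Gamma>) z \<longrightarrow>
            (\<exists>I. is_arg_min (nominal_cost c) (\<lambda>I. I \<in> \<I>) I \<and> supp z \<inter> I = {}))"
    (is "?strict \<longleftrightarrow> ?disjoint")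
proof -
  let ?Z = "budget_set \<Gamma> :: (real ^ 'n) set"
  let ?f = "scenario_cost c d J"
  let ?g = "min_scenario_cost \<I> c d"
  \<comment> \<open>The upper endpoint of \<open>eta_interval\<close> is \<open>?g w\<close>. This
    bounds \<open>?g z\<close> in one direction and makes every reduced set nonempty in the
    other.\<close>
  obtain w where w: "w \<in> ?Z" "\<And>y. y \<in> ?Z \<Longrightarrow> ?g y \<le> ?g w" "max_over ?Z ?g = ?g w"
    using max_over_attained[OF compact_budget_set _ continuous_on_min_scenario_cost]
      zero_in_budget_set assms(1) by (metis empty_iff)
  show ?thesis
  proof
    assume strict: ?strict
    show ?disjoint
    proof (intro allI impI, rule ccontr)
      fix z
      assume "is_arg_max ?f (\<lambda>z. z \<in> ?Z) z"
        and nex: "\<nexists>I. is_arg_min (nominal_cost c) (\<lambda>I. I \<in> \<I>) I \<and> supp z \<inter> I = {}"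
      then have z: "z \<in> ?Z" and opt: "\<And>y. y \<in> ?Z \<Longrightarrow> ?f y \<le> ?f z"
        by (auto simp: is_arg_max_linorder)
      \<comment> \<open>The choice \<open>\<eta> = ?g z\<close> keeps \<open>z\<close> itself in the
        reduced set, so both maxima equal \<open>?f z\<close>.\<close>
      have "?g z \<in> eta_interval \<I> c d \<Gamma>"
        using nex min_scenario_cost_gt_iff[OF assms(1,4) z] w z by (simp add: eta_interval_def)
      moreover have "max_over (reduced_set \<I> c d \<Gamma> (?g z)) ?f = ?f z"
        using z opt by (intro max_over_eq) (auto simp: reduced_set_def)
      moreover have "max_over ?Z ?f = ?f z"
        using z opt by (rule max_over_eq)
      ultimately show False
        using strict by force
    qed
  next
    assume disjoint: ?disjoint
    show ?strict
    proof
      fix \<eta>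
      assume \<eta>: "\<eta> \<in> eta_interval \<I> c d \<Gamma>"
      then have "w \<in> reduced_set \<I> c d \<Gamma> \<eta>"
        using w by (simp add: eta_interval_def reduced_set_def)
      then obtain z where z: "z \<in> reduced_set \<I> c d \<Gamma> \<eta>"
        and max_z: "max_over (reduced_set \<I> c d \<Gamma> \<eta>) ?f = ?f z"
        using max_over_attained[OF compact_reduced_set[OF assms(1)] _ continuous_on_scenario_cost]
        by (metis empty_iff)
      obtain y where y: "\<And>x. x \<in> ?Z \<Longrightarrow> ?f x \<le> ?f y" and max_y: "max_over ?Z ?f = ?f y"
        using max_over_attained[OF compact_budget_set _ continuous_on_scenario_cost]
          zero_in_budget_set by (metis empty_iff)
      have zZ: "z \<in> ?Z" and "\<eta> \<le> ?g z"
        using z by (auto simp: reduced_set_def)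
      \<comment> \<open>The half-open interval excludes the nominal minimum, so this is strict: the
        support of \<open>z\<close> meets every nominally optimal set, and \<open>disjoint\<close>
        rules out that \<open>z\<close> is optimal over \<open>?Z\<close>.\<close>
      then have "Min (nominal_cost c ` \<I>) < ?g z"
        using \<eta> by (simp add: eta_interval_def)
      then have "\<not> is_arg_max ?f (\<lambda>z. z \<in> ?Z) z"
        using disjoint min_scenario_cost_gt_iff[OF assms(1,4) zZ] by blast
      then obtain x where "x \<in> ?Z" "?f z < ?f x"
        using zZ by (auto simp: is_arg_max_def)
      then show "max_over (reduced_set \<I> c d \<Gamma> \<eta>) ?f < max_over ?Z ?f"
        using y max_y max_z by fastforce
    qed
  qed
qed

end
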